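(* Let $\alpha\in(0,2]$ and let $X=\{X(t),\,t\in\mathbb R_+\}$ be a real-valued self-similar $\alpha$-stable process with index $H>0$ and stationary increments. If the sample function $X(t)$ is almost surely bounded on $[0,1]$, then for every $\varepsilon>0$, $$\lim_{t\to\infty}\frac{|X(t)|}{t^H(\log t)^{\frac1\alpha+\varepsilon}}=0\quad\text{almost surely.}$$
   Context: $\mathbb R_+=[0,\infty)$. A real-valued stochastic process $X=\{X(t),t\in\mathbb R_+\}$ is self-similar with index $H>0$ if for all constants $c>0$, $\{X(ct),t\in\mathbb R_+\}\stackrel{d}{=}\{c^HX(t),t\in\mathbb R_+\}$, where $\stackrel{d}{=}$ means equality of all finite-dimensional distributions. $X$ has stationary increments if for every $t_0\in\mathbb R_+$, $\{X(t_0+t)-X(t_0),t\in\mathbb R_+\}\stackrel{d}{=}\{X(t)-X(0),t\in\mathbb R_+\}$. A process is $\alpha$-stable if all of its finite-dimensional distributions are $\alpha$-stable. The limit is as the continuous parameter $t$ tends to infinity.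
   Formalization: The process X is additionally assumed to be separable in Doob's sense; without this the claim fails, e.g. for Brownian motion with e^t added at the random times t = n + U, n ≥ 1, U uniform on (0,1). *)

theory Defs
  imports "HOL-Probability.Probability"
begin

text \<open>
  A process indexed by \<open>[0, \<infinity>)\<close> is a function \<open>X :: real \<Rightarrow> 'a \<Rightarrow> real\<close>; its values at
  negative times are never used.
\<close>

definition fidi_law :: "'a measure \<Rightarrow> (real \<Rightarrow> 'a \<Rightarrow> real) \<Rightarrow> real set \<Rightarrow> (real \<Rightarrow> real) measure" where
  "fidi_law M X J = distr M (\<Pi>\<^sub>M t\<in>J. borel) (\<lambda>\<omega>. \<lambda>t\<in>J. X t \<omega>)"

definition same_fidi :: "'a measure \<Rightarrow> (real \<Rightarrow> 'a \<Rightarrow> real) \<Rightarrow> (real \<Rightarrow> 'a \<Rightarrow> real) \<Rightarrow> bool" where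
  "same_fidi M X Y \<longleftrightarrow> (\<forall>J. finite J \<and> J \<subseteq> {0..} \<longrightarrow> fidi_law M X J = fidi_law M Y J)"

definition self_similar :: "'a measure \<Rightarrow> real \<Rightarrow> (real \<Rightarrow> 'a \<Rightarrow> real) \<Rightarrow> bool" where
  "self_similar M H X \<longleftrightarrow>
     (\<forall>c>0. same_fidi M (\<lambda>t \<omega>. X (c * t) \<omega>) (\<lambda>t \<omega>. c powr H * X t \<omega>))"

definition stationary_increments :: "'a measure \<Rightarrow> (real \<Rightarrow> 'a \<Rightarrow> real) \<Rightarrow> bool" where
  "stationary_increments M X \<longleftrightarrow>
     (\<forall>t0\<ge>0. same_fidi M (\<lambda>t \<omega>. X (t0 + t) \<omega> - X t0 \<omega>) (\<lambda>t \<omega>. X t \<omega> - X 0 \<omega>))"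

text \<open>
  \<open>\<alpha>\<close>-stability of a law \<open>\<mu>\<close> on \<open>\<real>\<^sup>J\<close>: if \<open>Y\<close>, \<open>Y'\<close> are independent with law \<open>\<mu>\<close>, then for all
  \<open>a, b > 0\<close> the vector \<open>a Y + b Y'\<close> is distributed as \<open>(a\<^sup>\<alpha> + b\<^sup>\<alpha>)\<^sup>1\<^sup>/\<^sup>\<alpha> Y + d\<close> for some
  \<open>d \<in> \<real>\<^sup>J\<close>.  Neither symmetry nor strict stability is required; \<open>\<alpha> = 2\<close> is the Gaussian case,
  and point masses count as \<open>\<alpha>\<close>-stable for every \<open>\<alpha>\<close>.
\<close>

definition stable_law :: "real \<Rightarrow> real set \<Rightarrow> (real \<Rightarrow> real) measure \<Rightarrow> bool" where
  "stable_law \<alpha> J \<mu> \<longleftrightarrow>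
     (\<forall>a>0. \<forall>b>0. \<exists>d.
        distr (\<mu> \<Otimes>\<^sub>M \<mu>) (\<Pi>\<^sub>M t\<in>J. borel) (\<lambda>(x, y). \<lambda>t\<in>J. a * x t + b * y t) =
        distr \<mu> (\<Pi>\<^sub>M t\<in>J. borel) (\<lambda>x. \<lambda>t\<in>J. (a powr \<alpha> + b powr \<alpha>) powr (1 / \<alpha>) * x t + d t))"

definition stable_process :: "'a measure \<Rightarrow> real \<Rightarrow> (real \<Rightarrow> 'a \<Rightarrow> real) \<Rightarrow> bool" where
  "stable_process M \<alpha> X \<longleftrightarrow>
     (\<forall>J. finite J \<and> J \<subseteq> {0..} \<longrightarrow> stable_law \<alpha> J (fidi_law M X J))"

text \<open>
  Separability in the sense of Doob, the usual standing convention for statements about sample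
  functions over uncountably many times.  Some such convention is needed: finite-dimensional
  distributions do not see a change of the process on \<open>{(t, \<omega>). \<exists>n\<ge>1. t = n + U \<omega>}\<close> with \<open>U\<close>
  uniform on \<open>(0, 1)\<close>, but growth as \<open>t \<rightarrow> \<infinity>\<close> does.  Taking \<open>F = {}\<close> shows that the separating
  set \<open>S\<close> is dense in \<open>[0, \<infinity>)\<close>.
\<close>

definition separable_process :: "'a measure \<Rightarrow> (real \<Rightarrow> 'a \<Rightarrow> real) \<Rightarrow> bool" where
  "separable_process M X \<longleftrightarrow>
     (\<exists>S. countable S \<and> S \<subseteq> {0..} \<and>
        (AE \<omega> in M. \<forall>I F. open I \<and> closed F \<and> (\<forall>s\<in>S \<inter> I. X s \<omega> \<in> F) \<longrightarrow>
                           (\<forall>t\<in>{0..} \<inter> I. X t \<omega> \<in> F)))"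

end

theory Submission
  imports Defs "HOL-Real_Asymp.Real_Asymp"
begin

text \<open>
  Write \<open>q\<close> for the supremum of the absolute values over a finite set of times in \<open>[0, 1]\<close>,
  \<open>p x\<close> for the probability that it exceeds \<open>x\<close>, and \<open>c = 2\<^sup>1\<^sup>/\<^sup>\<alpha>\<close>.  Stability with
  \<open>a = b = 1\<close> says that \<open>Y + Y'\<close> is distributed as \<open>c Y + d\<close>.  The event \<open>q (Y + Y') > x\<close>
  occurs when one summand exceeds \<open>x + m\<close> and the other does not exceed \<open>m\<close>, so
  \<open>2 p (x + m) (1 - p m) \<le> p ((x - K) / c)\<close> as soon as \<open>q d \<le> K\<close>.  For \<open>p m\<close> small, iteration
  gives \<open>p u = O(u\<^sup>-\<^sup>s)\<close> for every \<open>s < \<alpha>\<close>, with a constant that depends on the set of times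
  only through \<open>m\<close>.  Almost sure boundedness provides one \<open>m\<close> for all finite subsets of a
  countable set, hence the tail bound for suprema over countable sets.  By self-similarity the
  supremum over \<open>[0, e\<^sup>n)\<close> is \<open>e\<^sup>n\<^sup>H\<close> times such a supremum, and the Borel-Cantelli lemma applies
  to the thresholds \<open>e\<^sup>n\<^sup>H n\<^sup>b\<close> with \<open>1/\<alpha> < b < 1/\<alpha> + \<epsilon>\<close>.
\<close>

section \<open>Tail recursion and power-law tails for a single stable law\<close>

text \<open>The event \<open>q z > x\<close> of the outline; the existential form stays meaningful
  for empty \<open>J\<close>, where the event is empty.\<close>

definition exceed :: "real set \<Rightarrow> real \<Rightarrow> (real \<Rightarrow> real) set" where
  "exceed J x = {z \<in> space (\<Pi>\<^sub>M t\<in>J. borel). \<exists>t\<in>J. x < \<bar>z t\<bar>}"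

lemma sets_exceed [measurable]: "finite J \<Longrightarrow> exceed J x \<in> sets (\<Pi>\<^sub>M t\<in>J. borel)"
  unfolding exceed_def by measurable

lemma exceed_antimono: "x \<le> y \<Longrightarrow> exceed J y \<subseteq> exceed J x"
  unfolding exceed_def by (blast intro: le_less_trans)

text \<open>The shift \<open>d\<close> need not vanish, but \<open>p m \<le> 1/4\<close> bounds it
  by \<open>K = (2 + c) * m\<close> on all of \<open>J\<close>, whence the threshold on the right.
  Thus the recursion depends on \<open>J\<close> only through \<open>m\<close>.\<close>

lemma stable_law_tail_step:
  fixes M :: "(real \<Rightarrow> real) measure" and J :: "real set" and \<alpha> m x :: real
  defines "c \<equiv> 2 powr (1 / \<alpha>)"
  assumes "prob_space M" and setsM: "sets M = sets (\<Pi>\<^sub>M t\<in>J. borel)" and "finite J"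
    and stable: "stable_law \<alpha> J M"
    and m: "0 \<le> m" "measure M (exceed J m) \<le> 1 / 4" and "0 \<le> x"
  shows "2 * measure M (exceed J (x + m)) * (1 - measure M (exceed J m))
           \<le> measure M (exceed J ((x - (2 + c) * m) / c))"
proof -
  interpret prob_space M by fact
  let ?P = "\<Pi>\<^sub>M t\<in>J. borel :: real measure"
  note sets_eq [measurable_cong] = setsM
  interpret MM: pair_prob_space M M ..
  have spaceM: "space M = space ?P" using setsM by (rule sets_eq_imp_space_eq)
  have c: "0 < c" by (simp add: c_def)
  have [measurable]: "exceed J y \<in> sets M" for y using setsM \<open>finite J\<close> by simp
  obtain d where d: "distr (M \<Otimes>\<^sub>M M) ?P (\<lambda>(x, y). \<lambda>t\<in>J. x t + y t) =
      distr M ?P (\<lambda>x. \<lambda>t\<in>J. c * x t + d t)"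
    using stable unfolding stable_law_def c_def
    by (auto dest!: spec[of _ 1])
  define W where "W r = {p \<in> space (M \<Otimes>\<^sub>M M). \<exists>t\<in>J. r < \<bar>fst p t + snd p t\<bar>}" for r
  have [measurable]: "W r \<in> sets (M \<Otimes>\<^sub>M M)" for r
    unfolding W_def using \<open>finite J\<close> by measurable
  \<comment> \<open>Stability enters only through this identity: \<open>q (Y + Y') > r\<close> and
    \<open>q (c Y + d) > r\<close> have equal probability.\<close>
  have eqP: "measure (M \<Otimes>\<^sub>M M) (W r) =
      prob {y \<in> space M. \<exists>t\<in>J. r < \<bar>c * y t + d t\<bar>}" for r
  proof -
    have "measure (distr (M \<Otimes>\<^sub>M M) ?P (\<lambda>(x, y). \<lambda>t\<in>J. x t + y t)) (exceed J r) =
      measure (M \<Otimes>\<^sub>M M) (W r)"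
      using \<open>finite J\<close>
      by (subst measure_distr)
         (auto intro!: arg_cong[where f = "measure _"] simp: exceed_def W_def space_PiM space_pair_measure)
    moreover have "measure (distr M ?P (\<lambda>x. \<lambda>t\<in>J. c * x t + d t)) (exceed J r) =
      prob {y \<in> space M. \<exists>t\<in>J. r < \<bar>c * y t + d t\<bar>}"
      using \<open>finite J\<close>
      by (subst measure_distr)
         (auto intro!: arg_cong[where f = "measure _"] simp: exceed_def space_PiM)
    ultimately show ?thesis using d by simp
  qed
  have prod: "measure (M \<Otimes>\<^sub>M M) (A \<times> B) = prob A * prob B" if "A \<in> sets M" "B \<in> sets M" for A B
    using that by (simp add: measure_def emeasure_pair_measure_Times enn2real_mult)
  define G where "G = space M - exceed J m"
  have [measurable]: "G \<in> sets M" by (simp add: G_def)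
  have probG: "prob G = 1 - prob (exceed J m)" by (simp add: G_def prob_compl)
  have Gle: "\<bar>y t\<bar> \<le> m" if "y \<in> G" "t \<in> J" for y t
    using that spaceM by (auto simp: G_def exceed_def not_less)
  txt \<open>
    With probability at least \<open>(3/4)\<^sup>2\<close> we have \<open>\<bar>Y + Y'\<bar> \<le> 2 m\<close> throughout \<open>J\<close>; as
    \<open>(3/4)\<^sup>2 + 3/4 > 1\<close>, some point satisfies both \<open>\<bar>c Y + d\<bar> \<le> 2 m\<close> and \<open>\<bar>Y\<bar> \<le> m\<close>.
  \<close>
  have d_le: "\<bar>d t\<bar> \<le> (2 + c) * m" if "t \<in> J" for t
  proof -
    let ?E = "{y \<in> space M. \<exists>t\<in>J. 2 * m < \<bar>c * y t + d t\<bar>}"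
    have [measurable]: "?E \<in> sets M" using \<open>finite J\<close> by measurable
    have "measure (M \<Otimes>\<^sub>M M) (G \<times> G) + prob ?E =
        measure (M \<Otimes>\<^sub>M M) (G \<times> G \<union> W (2 * m))"
      unfolding eqP[symmetric] using \<open>finite J\<close>
    proof (intro MM.P.finite_measure_Union[symmetric])
      show "G \<times> G \<inter> W (2 * m) = {}"
      proof -
        have "\<not> 2 * m < \<bar>fst p t + snd p t\<bar>" if "p \<in> G \<times> G" "t \<in> J" for p t
          using Gle[of "fst p" t] Gle[of "snd p" t] that by (auto simp: mem_Times_iff)
        then show ?thesis unfolding W_def by blast
      qed
    qed measurable
    also have "\<dots> \<le> 1" by simp
    finally have "prob ?E \<le> 1 - (1 - prob (exceed J m))\<^sup>2"
      by (simp add: prod probG power2_eq_square)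
    also have "\<dots> \<le> 1 - (3 / 4)\<^sup>2"
      using m(2) by (intro diff_left_mono power_mono) auto
    finally have E: "prob ?E \<le> 7 / 16" by (simp add: power2_eq_square)
    have "\<exists>y\<in>G. y \<notin> ?E"
    proof (rule ccontr)
      assume "\<not> ?thesis"
      then have "prob G \<le> prob ?E" by (intro finite_measure_mono) auto
      with E m(2) probG show False by simp
    qed
    then obtain y where y: "y \<in> G" "y \<notin> ?E" by blast
    then have "\<bar>c * y t + d t\<bar> \<le> 2 * m" using that by (auto simp: G_def not_less)
    moreover have "\<bar>c * y t\<bar> \<le> c * m" using Gle[OF y(1) that] c by (simp add: abs_mult)
    ultimately show ?thesis by (simp add: algebra_simps)
  qed
  let ?A = "exceed J (x + m)"
  \<comment> \<open>This makes the rectangles \<open>?A \<times> G\<close> and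
    \<open>G \<times> ?A\<close> disjoint, so that their probabilities add up and give the factor
    2.\<close>
  have "?A \<inter> G = {}"
    using exceed_antimono[of m "x + m" J] \<open>0 \<le> x\<close> by (auto simp: G_def)
  then have "2 * prob ?A * (1 - prob (exceed J m)) = measure (M \<Otimes>\<^sub>M M) (?A \<times> G \<union> G \<times> ?A)"
    by (subst MM.P.finite_measure_Union) (auto simp: prod probG)
  also have "\<dots> \<le> measure (M \<Otimes>\<^sub>M M) (W x)"
  proof (rule MM.P.finite_measure_mono)
    have 1: "\<exists>t\<in>J. x < \<bar>y t + y' t\<bar>" if "y \<in> ?A" "y' \<in> G" for y y'
    proof -
      from that(1) obtain t where t: "t \<in> J" "x + m < \<bar>y t\<bar>" by (auto simp: exceed_def)
      with Gle[OF that(2) t(1)] show ?thesis by (intro bexI[of _ t]) auto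
    qed
    have 2: "\<exists>t\<in>J. x < \<bar>y' t + y t\<bar>" if "y \<in> ?A" "y' \<in> G" for y y'
      using 1[OF that] by (simp add: add.commute)
    have "?A \<subseteq> space M" "G \<subseteq> space M" by (auto simp: exceed_def spaceM G_def)
    then show "?A \<times> G \<union> G \<times> ?A \<subseteq> W x"
      by (auto simp: W_def space_pair_measure intro: 1 2)
  qed measurable
  also have "\<dots> = prob {y \<in> space M. \<exists>t\<in>J. x < \<bar>c * y t + d t\<bar>}" by (rule eqP)
  also have "\<dots> \<le> prob (exceed J ((x - (2 + c) * m) / c))"
  proof (rule finite_measure_mono)
    have "(x - (2 + c) * m) / c < \<bar>y t\<bar>" if "t \<in> J" "x < \<bar>c * y t + d t\<bar>" for y t
    proof -
      have "\<bar>c * y t + d t\<bar> \<le> c * \<bar>y t\<bar> + \<bar>d t\<bar>"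
        using abs_triangle_ineq[of "c * y t" "d t"] c by (simp add: abs_mult)
      then have "x - (2 + c) * m < c * \<bar>y t\<bar>" using d_le[OF that(1)] that(2) by linarith
      then show ?thesis using c by (simp add: field_simps)
    qed
    then show "{y \<in> space M. \<exists>t\<in>J. x < \<bar>c * y t + d t\<bar>} \<subseteq> exceed J ((x - (2 + c) * m) / c)"
      by (auto simp: exceed_def spaceM)
  qed measurable
  finally show ?thesis .
qed

text \<open>As \<open>2 * (1 - p m) \<ge> c powr s\<close>, each use of
  \<open>stable_law_tail_step\<close> gains a factor \<open>c powr (- s)\<close> while the threshold
  grows roughly by a factor \<open>c\<close>; hence the decay exponent \<open>s\<close>. The number
  \<open>- L\<close> is the fixed point of the threshold recursion
  \<open>x -> c x + (3 + c) m\<close>, so its orbit from 0 is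
  \<open>L * (c ^ k - 1)\<close>.\<close>

lemma stable_law_tail:
  fixes M :: "(real \<Rightarrow> real) measure" and J :: "real set" and \<alpha> m s u :: real
  defines "c \<equiv> 2 powr (1 / \<alpha>)"
  defines "L \<equiv> (3 + c) * m / (c - 1)"
  assumes "prob_space M" and setsM: "sets M = sets (\<Pi>\<^sub>M t\<in>J. borel)" and "finite J"
    and stable: "stable_law \<alpha> J M"
    and "0 < \<alpha>" "0 \<le> s" "0 < m" "0 < u"
    and m: "measure M (exceed J m) \<le> 1 / 4" "measure M (exceed J m) \<le> 1 - c powr s / 2"
  shows "measure M (exceed J u) \<le> (c * L) powr s * u powr (- s)"
proof -
  interpret prob_space M by fact
  have c: "1 < c" using \<open>0 < \<alpha>\<close> by (simp add: c_def)
  have L: "0 < L" using c \<open>0 < m\<close> by (simp add: L_def)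
  have ev: "exceed J y \<in> events" for y using setsM \<open>finite J\<close> by simp
  have anti: "prob (exceed J y) \<le> prob (exceed J x)" if "x \<le> y" for x y
    using exceed_antimono[OF that] ev by (intro finite_measure_mono)
  txt \<open>The thresholds solve \<open>x\<^sub>0 = 0\<close>, \<open>x\<^sub>k\<^sub>+\<^sub>1 = c x\<^sub>k + (3 + c) m\<close>.\<close>
  have geo: "prob (exceed J (L * (c ^ k - 1))) \<le> (c powr (- s)) ^ k" for k
  proof (induction k)
    case (Suc k)
    define x where "x = c * (L * (c ^ k - 1)) + (2 + c) * m"
    have "1 \<le> c ^ k" using c by (simp add: one_le_power)
    then have "0 \<le> x" using c L \<open>0 < m\<close> by (auto simp: x_def intro!: add_nonneg_nonneg)
    have "L * (c - 1) = (3 + c) * m" using c by (simp add: L_def)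
    then have xm: "x + m = L * (c ^ Suc k - 1)" by (simp add: x_def algebra_simps)
    have xc: "(x - (2 + c) * m) / c = L * (c ^ k - 1)" using c by (simp add: x_def)
    have "2 * prob (exceed J (x + m)) * (c powr s / 2)
        \<le> 2 * prob (exceed J (x + m)) * (1 - prob (exceed J m))"
      using m(2) by (intro mult_left_mono) auto
    also have "\<dots> \<le> prob (exceed J (L * (c ^ k - 1)))"
      using stable_law_tail_step[OF \<open>prob_space M\<close> setsM \<open>finite J\<close> stable _ m(1) \<open>0 \<le> x\<close>] \<open>0 < m\<close>
      by (simp add: xc flip: c_def)
    also have "\<dots> \<le> (c powr (- s)) ^ k" by (rule Suc)
    finally show ?case using c unfolding xm by (simp add: powr_minus divide_simps mult_ac)
  qed simp
  have powr_eq: "(c * L) powr s * u powr (- s) = (c * L / u) powr s"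
    using c L \<open>0 < u\<close> by (simp add: powr_divide powr_minus divide_simps)
  show ?thesis
  \<comment> \<open>For \<open>u \<le> L\<close> the claimed bound is at least 1.\<close>
  proof (cases "u \<le> L")
    case True
    then have "u \<le> c * L" using c L by (smt (verit) mult_less_cancel_right2)
    then have "1 \<le> (c * L / u) powr s"
      using \<open>0 < u\<close> \<open>0 \<le> s\<close> by (intro ge_one_powr_ge_zero) auto
    then show ?thesis unfolding powr_eq using prob_le_1[of "exceed J u"] by linarith
  next
    case False
    \<comment> \<open>The largest \<open>k\<close> with \<open>L * c ^ k \<le> u\<close>; the extra
      factor \<open>c\<close> in the constant pays for rounding down.\<close>
    define k where "k = nat \<lfloor>log c (u / L)\<rfloor>"
    have "0 \<le> log c (u / L)" using False c L by (simp add: zero_le_log_cancel_iff)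
    then have k: "real k \<le> log c (u / L)" "log c (u / L) < real k + 1"
      by (simp_all add: k_def)
    have "c ^ k \<le> u / L"
      using k(1) c L \<open>0 < u\<close> by (simp add: le_log_iff powr_realpow)
    then have "L * (c ^ k - 1) \<le> u" using L by (simp add: field_simps)
    then have "prob (exceed J u) \<le> (c powr (- s)) ^ k" using anti geo order.trans by blast
    also have "\<dots> = (c powr (- real k)) powr s"
      using c by (simp add: powr_powr mult.commute flip: powr_realpow)
    also have "\<dots> \<le> (c * L / u) powr s"
    proof (rule powr_mono2)
      have "u / L \<le> c powr (real k + 1)"
        using k(2) c L \<open>0 < u\<close> by (simp add: log_less_iff less_imp_le)
      then show "c powr (- real k) \<le> c * L / u"
        using c L \<open>0 < u\<close> by (simp add: powr_add powr_minus field_simps)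
    qed (use \<open>0 \<le> s\<close> in auto)
    finally show ?thesis unfolding powr_eq .
  qed
qed

section \<open>Uniform tail bounds over countable sets of times\<close>

lemma (in prob_space) prob_UN_countable_le:
  assumes "countable T" and A: "\<And>t. t \<in> T \<Longrightarrow> A t \<in> events"
    and le: "\<And>J. finite J \<Longrightarrow> J \<subseteq> T \<Longrightarrow> prob (\<Union>t\<in>J. A t) \<le> b"
  shows "prob (\<Union>t\<in>T. A t) \<le> b"
proof (cases "T = {}")
  case True
  then show ?thesis using le[of "{}"] by simp
next
  case False
  define e where "e = from_nat_into T"
  have T: "range e = T" unfolding e_def using False \<open>countable T\<close> by (rule range_from_nat_into)
  have "(\<lambda>n. prob (\<Union>t\<in>e ` {..n}. A t)) \<longlonglongrightarrow> prob (\<Union>n. \<Union>t\<in>e ` {..n}. A t)"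
    using T by (intro finite_Lim_measure_incseq) (fastforce simp: incseq_def intro!: A)+
  moreover have "prob (\<Union>t\<in>e ` {..n}. A t) \<le> b" for n using T by (intro le) auto
  ultimately have "prob (\<Union>n. \<Union>t\<in>e ` {..n}. A t) \<le> b" by (blast intro: LIMSEQ_le_const2)
  also have "(\<Union>n. \<Union>t\<in>e ` {..n}. A t) = (\<Union>t\<in>T. A t)"
    unfolding T[symmetric] by auto
  finally show ?thesis .
qed

lemma measure_fidi_law_exceed:
  assumes "\<And>t. t \<in> J \<Longrightarrow> X t \<in> borel_measurable M" "finite J"
  shows "measure (fidi_law M X J) (exceed J x) = measure M {\<omega> \<in> space M. \<exists>t\<in>J. x < \<bar>X t \<omega>\<bar>}"
  unfolding fidi_law_def using assms
  by (subst measure_distr)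
     (auto intro!: arg_cong[where f = "measure _"] measurable_restrict simp: exceed_def space_PiM)

text \<open>Boundedness on \<open>D\<close> gives one level that is rarely exceeded anywhere on
  \<open>D\<close>. It serves as \<open>m\<close> for every finite \<open>J \<subseteq> D\<close>,
  so \<open>C\<close> is independent of \<open>J\<close>.\<close>

lemma (in prob_space) stable_process_sup_tail:
  fixes X :: "real \<Rightarrow> 'a \<Rightarrow> real"
  assumes X: "\<And>t. t \<ge> 0 \<Longrightarrow> X t \<in> borel_measurable M"
    and stable: "stable_process M \<alpha> X" and "0 < \<alpha>" "0 \<le> s" "s < \<alpha>"
    and D: "countable D" "D \<subseteq> {0..}"
    and bdd: "AE \<omega> in M. bounded ((\<lambda>t. X t \<omega>) ` D)"
  obtains C where "\<And>J u. finite J \<Longrightarrow> J \<subseteq> D \<Longrightarrow> 0 < u \<Longrightarrow>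
    prob {\<omega> \<in> space M. \<exists>t\<in>J. u < \<bar>X t \<omega>\<bar>} \<le> C * u powr (- s)"
proof -
  define c where "c = 2 powr (1 / \<alpha>)"
  \<comment> \<open>Combines both smallness conditions of \<open>stable_law_tail\<close>; it is
    positive because \<open>c powr s = 2 powr (s / \<alpha>) < 2\<close>.\<close>
  define \<eta> where "\<eta> = min (1 / 4) (1 - c powr s / 2)"
  have "c powr s < 2 powr 1" unfolding c_def powr_powr
    using \<open>0 < \<alpha>\<close> \<open>s < \<alpha>\<close> by (intro powr_less_mono) auto
  then have "0 < \<eta>" by (simp add: \<eta>_def)
  define B where "B n = {\<omega> \<in> space M. \<exists>t\<in>D. real n < \<bar>X t \<omega>\<bar>}" for n :: nat
  have XD [measurable]: "X t \<in> borel_measurable M" if "t \<in> D" for t using X D that by auto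
  have B [measurable]: "B n \<in> events" for n
    unfolding B_def using D(1) by measurable
  have "(\<lambda>n. prob (B n)) \<longlonglongrightarrow> prob (\<Inter>n. B n)"
  proof (rule finite_Lim_measure_decseq)
    show "range B \<subseteq> events" using B by blast
    show "decseq B" unfolding B_def by (rule antimonoI) (auto intro: le_less_trans[OF of_nat_mono])
  qed
  moreover have "prob (\<Inter>n. B n) = 0"
  proof -
    from bdd have "AE \<omega> in M. \<omega> \<notin> (\<Inter>n. B n)"
    proof eventually_elim
      case (elim \<omega>)
      then obtain b where b: "\<And>t. t \<in> D \<Longrightarrow> \<bar>X t \<omega>\<bar> \<le> b" by (auto simp: bounded_iff)
      obtain n where "b \<le> real n" using real_arch_simple by blast
      with b have "\<omega> \<notin> B n" by (force simp: B_def)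
      then show ?case by blast
    qed
    then show ?thesis using B by (subst prob_eq_0) auto
  qed
  ultimately have "eventually (\<lambda>n. prob (B n) < \<eta>) sequentially"
    using \<open>0 < \<eta>\<close> by (auto dest: order_tendstoD)
  \<comment> \<open>The level \<open>real n\<close> must be positive to serve as \<open>m\<close> in
    \<open>stable_law_tail\<close>.\<close>
  then have "eventually (\<lambda>n. 0 < n \<and> prob (B n) < \<eta>) sequentially"
    using eventually_gt_at_top[of 0] by eventually_elim auto
  then obtain n where n: "0 < n" "prob (B n) < \<eta>"
    by (auto simp: eventually_sequentially)
  define L where "L = (3 + c) * real n / (c - 1)"
  show thesis
  proof (rule that)
    fix J u assume J: "finite J" "J \<subseteq> D" and "0 < (u :: real)"
    interpret F: prob_space "fidi_law M X J"
      unfolding fidi_law_def using J by (intro prob_space_distr measurable_restrict) auto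
    have eq: "F.prob (exceed J x) = prob {\<omega> \<in> space M. \<exists>t\<in>J. x < \<bar>X t \<omega>\<bar>}" for x
      using J by (intro measure_fidi_law_exceed) auto
    have "prob {\<omega> \<in> space M. \<exists>t\<in>J. real n < \<bar>X t \<omega>\<bar>} \<le> prob (B n)"
      using J(2) by (intro finite_measure_mono B) (auto simp: B_def)
    with n have pn: "F.prob (exceed J (real n)) \<le> \<eta>"
      unfolding eq by linarith
    have st: "stable_law \<alpha> J (fidi_law M X J)"
      using stable J D by (auto simp: stable_process_def)
    have "F.prob (exceed J u) \<le> (c * L) powr s * u powr (- s)"
      unfolding c_def L_def
      using pn n(1) \<open>0 < \<alpha>\<close> \<open>0 \<le> s\<close> \<open>0 < u\<close>
      by (intro stable_law_tail[OF F.prob_space_axioms _ J(1) st]) (auto simp: \<eta>_def c_def fidi_law_def)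
    then show "prob {\<omega> \<in> space M. \<exists>t\<in>J. u < \<bar>X t \<omega>\<bar>} \<le> (c * L) powr s * u powr (- s)"
      unfolding eq .
  qed
qed

section \<open>Scaling and exponential blocks\<close>

text \<open>With \<open>c = exp n\<close> this brings times in \<open>[0, exp n)\<close> back to the
  unit interval, where one tail constant serves for all \<open>n\<close>.\<close>

lemma self_similar_prob_exceed:
  assumes X: "\<And>t. t \<ge> 0 \<Longrightarrow> X t \<in> borel_measurable M"
    and ss: "self_similar M H X" and "0 < c" and J: "finite J" "J \<subseteq> {0..}"
  shows "measure M {\<omega> \<in> space M. \<exists>t\<in>J. c powr H * u < \<bar>X (c * t) \<omega>\<bar>} =
    measure M {\<omega> \<in> space M. \<exists>t\<in>J. u < \<bar>X t \<omega>\<bar>}"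
proof -
  have "fidi_law M (\<lambda>t \<omega>. X (c * t) \<omega>) J = fidi_law M (\<lambda>t \<omega>. c powr H * X t \<omega>) J"
    using ss \<open>0 < c\<close> J by (auto simp: self_similar_def same_fidi_def)
  moreover have "X t \<in> borel_measurable M" "X (c * t) \<in> borel_measurable M" if "t \<in> J" for t
    using that J \<open>0 < c\<close> by (auto intro!: X)
  ultimately have "measure M {\<omega> \<in> space M. \<exists>t\<in>J. c powr H * u < \<bar>X (c * t) \<omega>\<bar>} =
      measure M {\<omega> \<in> space M. \<exists>t\<in>J. c powr H * u < \<bar>c powr H * X t \<omega>\<bar>}"
    using J(1) by (subst (1 2) measure_fidi_law_exceed[symmetric]) auto
  then show ?thesis using \<open>0 < c\<close> by (simp add: abs_mult)
qed

text \<open>For \<open>n \<le> ln t + 1\<close>, replacing \<open>exp n\<close> by \<open>t\<close>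
  costs at most a factor \<open>exp H\<close>, and replacing \<open>n\<close> by \<open>ln t\<close>
  a factor tending to 1. What remains is \<open>ln t powr (b - b')\<close>, which tends to
  0.\<close>

lemma tendsto_0_of_exp_blocks:
  fixes f :: "real \<Rightarrow> real"
  assumes ev: "\<forall>\<^sub>F n in sequentially. \<forall>t\<in>{0..<exp (real n)}. \<bar>f t\<bar> \<le> exp (real n) powr H * real n powr b"
    and "0 \<le> H" "0 \<le> b" "b < b'"
  shows "((\<lambda>t. \<bar>f t\<bar> / (t powr H * ln t powr b')) \<longlongrightarrow> 0) at_top"
proof (rule tendsto_sandwich[where f = "\<lambda>_. 0"])
  \<comment> \<open>For \<open>t > 1\<close> this is the first \<open>n\<close> with
    \<open>t < exp n\<close>; the \<open>+ 1\<close> makes the inequality strict.\<close>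
  have "filterlim (\<lambda>t::real. nat \<lfloor>ln t\<rfloor> + 1) at_top at_top"
    unfolding Suc_eq_plus1[symmetric]
    by (intro filterlim_compose[OF filterlim_Suc] filterlim_compose[OF filterlim_nat_sequentially]
          filterlim_compose[OF filterlim_floor_sequentially] ln_at_top)
  from eventually_compose_filterlim[OF ev this]
  have "\<forall>\<^sub>F t in at_top. \<bar>f t\<bar> \<le> exp (real (nat \<lfloor>ln t\<rfloor> + 1)) powr H * real (nat \<lfloor>ln t\<rfloor> + 1) powr b"
    using eventually_gt_at_top[of 1]
  proof eventually_elim
    case (elim t)
    have "t < exp (real (nat \<lfloor>ln t\<rfloor> + 1))"
      using elim(2) exp_less_cancel_iff[of "ln t" "real (nat \<lfloor>ln t\<rfloor> + 1)"]
      by simp linarith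
    then show ?case using elim by auto
  qed
  then show "\<forall>\<^sub>F t in at_top. \<bar>f t\<bar> / (t powr H * ln t powr b') \<le>
      exp H * ((1 + 1 / ln t) powr b * ln t powr (b - b'))"
    using eventually_gt_at_top[of 1]
  proof eventually_elim
    case (elim t)
    let ?n = "real (nat \<lfloor>ln t\<rfloor> + 1)"
    have l: "0 < ln t" using elim by simp
    then have n: "?n \<le> ln t + 1" by simp
    have "\<bar>f t\<bar> \<le> exp ?n powr H * ?n powr b" by (rule elim)
    also have "\<dots> \<le> exp (ln t + 1) powr H * (ln t + 1) powr b"
      using n \<open>0 \<le> H\<close> \<open>0 \<le> b\<close> by (intro mult_mono powr_mono2) auto
    also have "exp (ln t + 1) powr H = exp H * t powr H"
      using elim by (simp add: exp_add powr_mult exp_powr_real)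
    also have "ln t + 1 = (1 + 1 / ln t) * ln t" using l by (simp add: field_simps)
    also have "\<dots> powr b = (1 + 1 / ln t) powr b * ln t powr b"
      using l by (simp add: powr_mult)
    finally show ?case using l elim by (simp add: powr_diff field_simps)
  qed
  show "((\<lambda>t. exp H * ((1 + 1 / ln t) powr b * ln t powr (b - b'))) \<longlongrightarrow> 0) at_top"
  proof -
    have "((\<lambda>t. 1 + 1 / ln t) \<longlongrightarrow> (1::real)) at_top" by real_asymp
    then have "((\<lambda>t. (1 + 1 / ln t) powr b) \<longlongrightarrow> (1::real) powr b) at_top"
      by (intro tendsto_powr tendsto_const) auto
    moreover have "((\<lambda>t. ln t powr (b - b')) \<longlongrightarrow> 0) at_top"
      using \<open>b < b'\<close> by (intro tendsto_neg_powr ln_at_top) auto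
    ultimately have "((\<lambda>t. exp H * ((1 + 1 / ln t) powr b * ln t powr (b - b')))
        \<longlongrightarrow> exp H * (1 powr b * 0)) at_top"
      by (intro tendsto_mult tendsto_const)
    then show ?thesis by simp
  qed
qed (auto intro!: always_eventually)

section \<open>Borel-Cantelli over the blocks \<open>[0, exp n)\<close>\<close>

theorem theorem2p3:
  fixes M :: "'a measure" and X :: "real \<Rightarrow> 'a \<Rightarrow> real" and \<alpha> H \<epsilon> :: real
  assumes "prob_space M"
    and "\<And>t. t \<ge> 0 \<Longrightarrow> X t \<in> borel_measurable M"
    and "separable_process M X"
    and "0 < \<alpha>" and "\<alpha> \<le> 2"
    and "stable_process M \<alpha> X"
    and "0 < H"
    and "self_similar M H X"
    and "stationary_increments M X"
    and "AE \<omega> in M. bounded ((\<lambda>t. X t \<omega>) ` {0..1})"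
    and "0 < \<epsilon>"
  shows "AE \<omega> in M. ((\<lambda>t. \<bar>X t \<omega>\<bar> / (t powr H * ln t powr (1 / \<alpha> + \<epsilon>))) \<longlongrightarrow> 0) at_top"
proof -
  interpret prob_space M by fact
  note X = assms(2)
  \<comment> \<open>The gap above \<open>1 / \<alpha>\<close> leaves room for some
    \<open>s < \<alpha>\<close> with \<open>b * s > 1\<close>, which gives summability; the gap
    below \<open>1 / \<alpha> + \<epsilon>\<close> gives the final decay in
    \<open>ln t\<close>.\<close>
  define b where "b = 1 / \<alpha> + \<epsilon> / 2"
  have b: "1 / \<alpha> < b" "b < 1 / \<alpha> + \<epsilon>" "0 < b"
    using \<open>0 < \<alpha>\<close> \<open>0 < \<epsilon>\<close> by (auto simp: b_def intro!: add_pos_pos)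
  have "1 / b < \<alpha>" using b \<open>0 < \<alpha>\<close> by (simp add: field_simps)
  then obtain s where s: "1 / b < s" "s < \<alpha>" using dense by blast
  have "0 < s" using s(1) b(3) by (smt (verit) divide_pos_pos)
  obtain S where S: "countable S" "S \<subseteq> {0..}"
    and sep: "AE \<omega> in M. \<forall>I F. open I \<and> closed F \<and> (\<forall>s\<in>S \<inter> I. X s \<omega> \<in> F) \<longrightarrow>
                           (\<forall>t\<in>{0..} \<inter> I. X t \<omega> \<in> F)"
    using \<open>separable_process M X\<close> unfolding separable_process_def by auto
  txt \<open>Contains the rescaled times of all blocks, so that one constant serves for every \<open>n\<close>.\<close>
  define D where "D = (\<Union>n::nat. (\<lambda>t. t / exp (real n)) ` (S \<inter> {..<exp (real n)}))"
  have D: "countable D" using S(1) by (auto simp: D_def)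
  have D01: "D \<subseteq> {0..1}" using S(2) by (auto simp: D_def)
  have bddD: "AE \<omega> in M. bounded ((\<lambda>t. X t \<omega>) ` D)"
    using assms(10) by eventually_elim (use D01 in \<open>blast intro: bounded_subset\<close>)
  obtain C where C: "\<And>J u. finite J \<Longrightarrow> J \<subseteq> D \<Longrightarrow> 0 < u \<Longrightarrow>
      prob {\<omega> \<in> space M. \<exists>t\<in>J. u < \<bar>X t \<omega>\<bar>} \<le> C * u powr (- s)"
  proof (rule stable_process_sup_tail[OF X \<open>stable_process M \<alpha> X\<close> \<open>0 < \<alpha>\<close> _ \<open>s < \<alpha>\<close> D _ bddD])
  qed (use \<open>0 < s\<close> D01 in auto)
  define A where "A n = (\<Union>t\<in>S \<inter> {..<exp (real n)}.
      {\<omega> \<in> space M. exp (real n) powr H * real n powr b < \<bar>X t \<omega>\<bar>})" for n :: nat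
  have XS [measurable]: "X t \<in> borel_measurable M" if "t \<in> S" for t using S(2) X that by auto
  have A: "A n \<in> events" for n
    unfolding A_def using S(1) by (intro sets.countable_UN') auto
  \<comment> \<open>At \<open>n = 0\<close> the threshold is \<open>0 powr b = 0\<close>, outside
    the range of the tail bound.\<close>
  have probA: "prob (A n) \<le> C * real n powr (- (b * s))" if "0 < n" for n
    unfolding A_def
  proof (rule prob_UN_countable_le)
    fix J assume J: "finite J" "J \<subseteq> S \<inter> {..<exp (real n)}"
    \<comment> \<open>The rescaled times lie in \<open>D\<close>, and self-similarity cancels
      \<open>exp n powr H\<close>, leaving the threshold \<open>n powr b\<close>.\<close>
    define J' where "J' = (\<lambda>t. t / exp (real n)) ` J"
    have J': "finite J'" "J' \<subseteq> D" using J by (auto simp: J'_def D_def)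
    have "(\<Union>t\<in>J. {\<omega> \<in> space M. exp (real n) powr H * real n powr b < \<bar>X t \<omega>\<bar>}) =
      {\<omega> \<in> space M. \<exists>t\<in>J'. exp (real n) powr H * real n powr b < \<bar>X (exp (real n) * t) \<omega>\<bar>}"
      by (auto simp: J'_def)
    also have "prob \<dots> = prob {\<omega> \<in> space M. \<exists>t\<in>J'. real n powr b < \<bar>X t \<omega>\<bar>}"
      using J' D01 by (intro self_similar_prob_exceed[OF X \<open>self_similar M H X\<close>]) force+
    also have "\<dots> \<le> C * (real n powr b) powr (- s)" using that by (intro C J') simp
    finally show "prob (\<Union>t\<in>J. {\<omega> \<in> space M. exp (real n) powr H * real n powr b < \<bar>X t \<omega>\<bar>})
        \<le> C * real n powr (- (b * s))" by (simp add: powr_powr)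
  qed (use S(1) in auto)
  have "1 < b * s" using s(1) b(3) by (simp add: field_simps)
  then have "summable (\<lambda>n. C * real n powr (- (b * s)))"
    by (intro summable_mult) (simp add: summable_real_powr_iff)
  then have "summable (\<lambda>n. prob (A n))"
    by (rule summable_comparison_test'[where N = 1]) (simp add: probA)
  then have "AE \<omega> in M. \<forall>\<^sub>F n in sequentially. \<omega> \<in> space M - A n"
    by (intro borel_cantelli_AE1 A) (auto simp: emeasure_eq_measure)
  with sep show ?thesis
  proof eventually_elim
    case (elim \<omega>)
    note sep_\<omega> = elim(1)
    have "\<forall>\<^sub>F n in sequentially. \<forall>t\<in>{0..<exp (real n)}.
        \<bar>X t \<omega>\<bar> \<le> exp (real n) powr H * real n powr b"
      using elim(2)
    proof eventually_elim
      case (elim n)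
      let ?r = "exp (real n) powr H * real n powr b"
      have "X t \<omega> \<in> {- ?r..?r}" if "t \<in> S \<inter> {..<exp (real n)}" for t
        using elim that by (force simp: A_def)
      \<comment> \<open>Separability carries the bound from \<open>S\<close> to all times of the
        block; the open set it needs is the reason for excluding the right endpoint.\<close>
      then have "\<forall>t\<in>{0..} \<inter> {..<exp (real n)}. X t \<omega> \<in> {- ?r..?r}"
        using sep_\<omega>[THEN spec, THEN spec, of "{..<exp (real n)}" "{- ?r..?r}"] by auto
      then show ?case by (force simp: abs_le_iff)
    qed
    then show ?case
      using \<open>0 < H\<close> b by (intro tendsto_0_of_exp_blocks) auto
  qed
qed

end
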